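(* Let $G$ be a countable group and $\mathcal F\subset\mathcal P_G$ a Borel left-invariant lower family, where $\mathcal P_G$ is identified with the compact metrizable space $2^G$. Then: (1) for every ordinal $\alpha<\omega_1$ the family $\tau^\alpha(\mathcal F)$ is Borel in $\mathcal P_G$; (2) the family $\tau^*(\mathcal F)=\tau^{<\omega_1}(\mathcal F)$ is coanalytic; (3) if $\tau^*(\mathcal F)\ne\tau^\alpha(\mathcal F)$ for all $\alpha<\omega_1$, then $\tau^*(\mathcal F)$ is not Borel in $\mathcal P_G$.
   Context: Subsets $A\subset G$ are identified with their characteristic functions in $2^G$ (product topology). Left-invariant: $xF\in\mathcal F$ for $F\in\mathcal F$, $x\in G$; lower: closed under subsets. $\tau(\mathcal F)=\{A\subset G: xA\cap yA\in\mathcal F$ for all distinct $x,y\in G\}$, $\tau^0(\mathcal F)=\mathcal F$, $\tau^{<\alpha}(\mathcal F)=\bigcup_{\beta<\alpha}\tau^\beta(\mathcal F)$, $\tau^\alpha(\mathcal F)=\tau(\tau^{<\alpha}(\mathcal F))$ for $\alpha>0$; $\tau^*(\mathcal F)$ is the smallest family $\tilde{\mathcal F}\supset\mathcal F$ with $\tau(\tilde{\mathcal F})=\tilde{\mathcal F}$. A subset of a Polish space is analytic if it is a continuous image of a Polish space, coanalytic if its complement is analytic. *)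

theory Defs
  imports "HOL-Analysis.Analysis"
begin

text \<open>Groups are written additively via the (not necessarily commutative) class group_add;
  the left translate xA of the paper is  (+) x ` A.\<close>

definition left_invariant_family :: "'g::group_add set set \<Rightarrow> bool" where
  "left_invariant_family \<F> \<longleftrightarrow> (\<forall>F\<in>\<F>. \<forall>x. (+) x ` F \<in> \<F>)"

definition lower_family :: "'g set set \<Rightarrow> bool" where
  "lower_family \<F> \<longleftrightarrow> (\<forall>A\<in>\<F>. \<forall>B. B \<subseteq> A \<longrightarrow> B \<in> \<F>)"

definition tau_op :: "'g::group_add set set \<Rightarrow> 'g set set" where
  "tau_op \<F> = {A. \<forall>x y. x \<noteq> y \<longrightarrow> ((+) x ` A \<inter> (+) y ` A) \<in> \<F>}"

text \<open>Countable ordinals are represented by well-orders r on subsets of nat (alpha = order type of r).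
  tau_level r F a = tau^beta(F), where beta is the position of a in r.\<close>
definition tau_level :: "nat rel \<Rightarrow> 'g::group_add set set \<Rightarrow> nat \<Rightarrow> 'g set set" where
  "tau_level r \<F> = wfrec (r - Id)
     (\<lambda>L a. if underS r a = {} then \<F> else tau_op (\<Union>b\<in>underS r a. L b))"

definition tau_ord :: "nat rel \<Rightarrow> 'g::group_add set set \<Rightarrow> 'g set set" where
  "tau_ord r \<F> = (if Field r = {} then \<F> else tau_op (\<Union>a\<in>Field r. tau_level r \<F> a))"

definition tau_lt_omega1 :: "'g::group_add set set \<Rightarrow> 'g set set" where
  "tau_lt_omega1 \<F> = (\<Union>r\<in>{r::nat rel. Well_order r}. tau_ord r \<F>)"

definition tau_star :: "'g::group_add set set \<Rightarrow> 'g set set" where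
  "tau_star \<F> = (THE H. \<F> \<subseteq> H \<and> tau_op H = H \<and>
                   (\<forall>H'. \<F> \<subseteq> H' \<and> tau_op H' = H' \<longrightarrow> H \<subseteq> H'))"

text \<open>Identification of P_G with 2^G = ('g => bool) (product topology of discrete bool).\<close>
definition char_fam :: "'g set set \<Rightarrow> ('g \<Rightarrow> bool) set" where
  "char_fam \<F> = (\<lambda>A. (\<lambda>g. g \<in> A)) ` \<F>"

definition borel_family :: "'g set set \<Rightarrow> bool" where
  "borel_family \<F> \<longleftrightarrow> char_fam \<F> \<in> sets borel"

definition polish_topology :: "'a topology \<Rightarrow> bool" where
  "polish_topology X \<longleftrightarrow> completely_metrizable_space X \<and> separable_space X"

text \<open>Analytic = continuous image of a Polish space. Every Polish space has cardinality at most
  the continuum, hence is homeomorphic to a Polish topology on a subset of real.\<close>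
definition analytic_set :: "'b::topological_space set \<Rightarrow> bool" where
  "analytic_set S \<longleftrightarrow> (\<exists>(X::real topology) f. polish_topology X \<and>
      continuous_map X euclidean f \<and> f ` topspace X = S)"

definition coanalytic_family :: "'g set set \<Rightarrow> bool" where
  "coanalytic_family \<F> \<longleftrightarrow> analytic_set (UNIV - char_fam \<F>)"

end

theory Submission
  imports Defs
begin

text \<open>
  For a finite sequence \<open>s\<close> of pairs of distinct elements of \<open>G\<close> let \<open>A\<^sub>s\<close> arise from \<open>A\<close> by
  successively replacing a set \<open>B\<close> by \<open>xB \<inter> yB\<close>, and let \<open>T(A)\<close> be the tree of all \<open>s\<close> with
  \<open>A\<^sub>s \<notin> \<F>\<close>. The sets \<open>A\<close> for which \<open>T(A)\<close> has no infinite branch form the least fixed point of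
  \<open>\<tau>\<close> above \<open>\<F>\<close>, and \<open>A\<close> belongs to \<open>\<tau>\<^sup>\<alpha>(\<F>)\<close> as soon as \<open>T(A)\<close> has a rank function into
  \<open>\<alpha>\<close>. Having an infinite branch is an analytic condition, because the sets \<open>{A. s \<in> T(A)}\<close> are
  Borel. If \<open>\<tau>\<^sup>*(\<F>)\<close> is Borel, then each set \<open>{A \<in> \<tau>\<^sup>*(\<F>). s \<in> T(A)}\<close> is the projection of a closed
  subset of \<open>2\<^sup>G \<times> \<nat>\<^sup>\<nat>\<close>; finite approximations to points of these closed sets form a single
  countable well-founded relation into which all the trees \<open>T(A)\<close> with \<open>A \<in> \<tau>\<^sup>*(\<F>)\<close> map
  monotonically (the Kunen--Martin argument), so the ranks are bounded by a countable ordinal.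
\<close>

section \<open>Well-founded relations on countable types\<close>

text \<open>\<open>X\<close> stands in for the first uncountable ordinal: it is the shortest
  uncountable initial segment of a well-order of the reals, or all of them if every proper segment
  is countable.\<close>

lemma obtain_omega1_like_order:
  obtains R :: "real rel" and X where "Well_order R" "Field R = UNIV" "uncountable X"
    "\<And>x. x \<in> X \<Longrightarrow> countable (under R x)"
proof -
  obtain R :: "real rel" where R: "Well_order R" "Field R = UNIV"
    using well_ordering[where 'a = real] by auto
  have wf: "wf (R - Id)" using R by (simp add: well_order_on_def)
  have under: "under R x \<subseteq> insert x (underS R x)" for x
    by (auto simp: under_def underS_def)
  show thesis
  proof (cases "\<exists>x. uncountable (underS R x)")
    case True
    then obtain x where x: "uncountable (underS R x)"
      and min: "\<And>y. (y, x) \<in> R - Id \<Longrightarrow> countable (underS R y)"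
      using wfE_min[OF wf, of _ "{x. uncountable (underS R x)}"] by (metis mem_Collect_eq)
    have "countable (under R y)" if "y \<in> underS R x" for y
      by (rule countable_subset[OF under]) (use that min in \<open>auto simp: underS_def\<close>)
    with x R show thesis by (intro that[of R "underS R x"]) auto
  next
    case False
    then have "countable (under R y)" for y
      by (meson under countable_insert countable_subset)
    with R uncountable_UNIV_real show thesis by (intro that[of R UNIV]) auto
  qed
qed

text \<open>The rank of the relation takes values in an order all of whose proper initial segments are
  countable, where the values at countably many predecessors always have a strict upper bound; ties
  are broken by the enumeration of the type.\<close>

lemma wf_countable_extends_to_Well_order:
  fixes W :: "'a::countable rel"
  assumes "wf W"
  obtains r :: "nat rel" where "Well_order r" "Field r = UNIV"
    "\<And>x y. (x, y) \<in> W \<Longrightarrow> (to_nat x, to_nat y) \<in> r - Id"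
proof -
  obtain R :: "real rel" and X where R: "Well_order R" "Field R = UNIV" and X: "uncountable X"
    and under: "\<And>x. x \<in> X \<Longrightarrow> countable (under R x)"
    using obtain_omega1_like_order by blast
  have wfR: "wf (R - Id)" and linR: "Linear_order R"
    using R by (auto simp: well_order_on_def)
  have totR: "(x, y) \<in> R \<or> (y, x) \<in> R" for x y
    using linR R(2) by (auto simp: linear_order_on_def total_on_def partial_order_on_def
        preorder_on_def refl_on_def) metis
  have transR: "trans R" and antisymR: "antisym R"
    using linR by (auto simp: linear_order_on_def partial_order_on_def preorder_on_def)
  define p where "p = {(m, n). \<exists>x y. (x, y) \<in> W \<and> m = to_nat x \<and> n = to_nat y}"
  have wfp: "wf p"
  proof (rule wf_subset[OF wf_inv_image[OF assms, of from_nat]])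
    show "p \<subseteq> inv_image W from_nat" by (auto simp: p_def inv_image_def)
  qed
  define rk where "rk = wfrec p (\<lambda>L n. SOME z. z \<in> X \<and> (\<forall>m. (m, n) \<in> p \<longrightarrow> (L m, z) \<in> R - Id))"
  have rk_unfold: "rk n = (SOME z. z \<in> X \<and> (\<forall>m. (m, n) \<in> p \<longrightarrow> (rk m, z) \<in> R - Id))" for n
  proof -
    have "(\<lambda>z. z \<in> X \<and> (\<forall>m. (m, n) \<in> p \<longrightarrow> (cut rk p n m, z) \<in> R - Id)) =
        (\<lambda>z. z \<in> X \<and> (\<forall>m. (m, n) \<in> p \<longrightarrow> (rk m, z) \<in> R - Id))"
      by (simp add: cut_apply cong: imp_cong)
    then show ?thesis unfolding rk_def by (subst wfrec[OF wfp]) simp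
  qed
  have rk: "rk n \<in> X \<and> (\<forall>m. (m, n) \<in> p \<longrightarrow> (rk m, rk n) \<in> R - Id)" for n
  proof (induction n rule: wf_induct_rule[OF wfp])
    case (1 n)
    have "countable (\<Union>m\<in>{m. (m, n) \<in> p}. under R (rk m))"
      using 1 under by (intro countable_UN) auto
    then have "\<not> X \<subseteq> (\<Union>m\<in>{m. (m, n) \<in> p}. under R (rk m))"
      using X countable_subset by blast
    then obtain z where z: "z \<in> X" "\<And>m. (m, n) \<in> p \<Longrightarrow> z \<notin> under R (rk m)"
      by auto
    have "\<exists>z. z \<in> X \<and> (\<forall>m. (m, n) \<in> p \<longrightarrow> (rk m, z) \<in> R - Id)"
    proof (intro exI conjI allI impI)
      fix m assume "(m, n) \<in> p"
      with z totR[of z "rk m"] totR[of z z] show "(rk m, z) \<in> R - Id"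
        by (auto simp: under_def)
    qed (use z in auto)
    then show ?case by (subst (1 3) rk_unfold) (rule someI_ex)
  qed
  define r where "r = {(m, n). (rk m, rk n) \<in> R - Id \<or> rk m = rk n \<and> m \<le> n}"
  have "r - Id \<subseteq> inv_image ((R - Id) <*lex*> less_than) (\<lambda>n. (rk n, n))"
    by (auto simp: r_def inv_image_def)
  then have "wf (r - Id)"
    by (rule wf_subset[rotated]) (intro wf_inv_image wf_lex_prod wfR wf_less_than)
  moreover have "Linear_order r"
  proof -
    have "refl r" by (auto simp: r_def refl_on_def)
    moreover have "trans r"
      using transR antisymR by (auto simp: r_def trans_def antisym_def)
    moreover have "antisym r"
      using antisymR by (auto simp: r_def antisym_def) 
    moreover have "total r"
      using totR by (auto simp: r_def total_on_def)
    moreover have "Field r = UNIV" using \<open>refl r\<close> by (auto simp: Field_def refl_on_def)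
    ultimately show ?thesis by (auto simp: linear_order_on_def partial_order_on_def preorder_on_def)
  qed
  moreover have "Field r = UNIV" by (force simp: r_def Field_def)
  moreover have "(to_nat x, to_nat y) \<in> r - Id" if "(x, y) \<in> W" for x y
  proof -
    have "(to_nat x, to_nat y) \<in> p" using that by (auto simp: p_def)
    then have "(rk (to_nat x), rk (to_nat y)) \<in> R - Id" using rk by blast
    then show ?thesis by (auto simp: r_def)
  qed
  ultimately show thesis by (intro that[of r]) (auto simp: well_order_on_def)
qed

section \<open>Trees of finite sequences\<close>

text \<open>Finite sequences are stored in reverse, so that a successor of \<open>s\<close> is \<open>p # s\<close>.\<close>

primrec rev_init :: "(nat \<Rightarrow> 'a) \<Rightarrow> nat \<Rightarrow> 'a list" where
  "rev_init f 0 = []"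
| "rev_init f (Suc n) = f n # rev_init f n"

lemma rev_init_conv: "rev_init f n = rev (map f [0..<n])"
  by (induction n) auto

lemma rev_init_Suc_shift: "rev_init f (Suc n) = rev_init (\<lambda>k. f (Suc k)) n @ [f 0]"
  by (induction n) auto

lemma chain_append:
  assumes "\<And>k. \<exists>p. s (Suc k) = p # s k"
  shows "\<exists>u. s (k + j) = u @ s k"
proof (induction j)
  case (Suc j)
  then show ?case using assms[of "k + j"] by (metis add_Suc_right append_Cons)
qed auto

lemma chain_length:
  assumes "\<And>k. \<exists>p. s (Suc k) = p # s k"
  shows "n \<le> length (s n)"
proof (induction n)
  case (Suc n)
  then show ?case using assms[of n] by auto
qed auto

text \<open>The list \<open>s 0\<close> is arbitrary, so the branch appears only through suffixes:
  entries counted from the end of a list never change once they exist.\<close>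

lemma chain_has_branch:
  assumes "\<And>k. \<exists>p. s (Suc k) = p # s k"
  obtains f where "\<And>n. \<exists>u. s n = u @ rev_init f n"
proof
  note ext = chain_append[of s, OF assms] and len = chain_length[of s, OF assms]
  define f where "f i = rev (s (Suc i)) ! i" for i
  fix n
  have "rev (s n) ! i = f i" if i: "i < n" for i
  proof -
    obtain u where "s n = u @ s (Suc i)" using ext[of "Suc i" "n - Suc i"] i by auto
    then show ?thesis using len[of "Suc i"] by (simp add: f_def nth_append)
  qed
  then have "take n (rev (s n)) = map f [0..<n]"
    using len[of n] by (intro nth_equalityI) auto
  then have "rev (s n) = rev (rev_init f n) @ drop n (rev (s n))"
    by (metis append_take_drop_id rev_init_conv rev_rev_ident)
  then show "\<exists>u. s n = u @ rev_init f n"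
    by (metis rev_append rev_rev_ident)
qed

text \<open>A descending chain may start at any node; closure under tails brings the initial
  segments of its branch into \<open>T\<close>.\<close>

lemma wf_tree_if_no_branch:
  assumes tl: "\<And>p s. p # s \<in> T \<Longrightarrow> s \<in> T"
    and nobranch: "\<nexists>f. \<forall>n. rev_init f n \<in> T"
  shows "wf {(p # s, s) |p s. p # s \<in> T}"
proof (rule ccontr)
  assume "\<not> ?thesis"
  then obtain s where s: "\<And>k. (s (Suc k), s k) \<in> {(p # s, s) |p s. p # s \<in> T}"
    unfolding wf_iff_no_infinite_down_chain by blast
  then have step: "\<exists>p. s (Suc k) = p # s k" for k by blast
  have mem: "s k \<in> T" for k using s[of k] tl by blast
  obtain f where f: "\<And>n. \<exists>u. s n = u @ rev_init f n"
    using chain_has_branch step by blast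
  have "u @ t \<in> T \<Longrightarrow> t \<in> T" for u t by (induction u) (auto dest: tl)
  with f mem have "rev_init f n \<in> T" for n by metis
  with nobranch show False by blast
qed

section \<open>The operation on families and its iterates\<close>

lemma tau_op_mono: "\<F> \<subseteq> \<G> \<Longrightarrow> tau_op \<F> \<subseteq> tau_op \<G>"
  by (auto simp: tau_op_def)

lemma tau_op_increasing:
  assumes "left_invariant_family \<F>" "lower_family \<F>"
  shows "\<F> \<subseteq> tau_op \<F>"
  using assms unfolding tau_op_def left_invariant_family_def lower_family_def
  by (auto, meson Int_lower1)

lemma tau_level_unfold:
  assumes "wf (r - Id)"
  shows "tau_level r \<F> a =
    (if underS r a = {} then \<F> else tau_op (\<Union>b\<in>underS r a. tau_level r \<F> b))"
proof -
  have "(\<Union>b\<in>underS r a. cut (tau_level r \<F>) (r - Id) a b) = (\<Union>b\<in>underS r a. tau_level r \<F> b)"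
    by (auto simp: cut_apply underS_def)
  then show ?thesis
    unfolding tau_level_def by (subst wfrec[OF assms]) simp
qed

lemma tau_op_tau_level_le:
  assumes "wf (r - Id)" "(b, a) \<in> r - Id"
  shows "tau_op (tau_level r \<F> b) \<subseteq> tau_level r \<F> a"
proof -
  have "b \<in> underS r a" using assms by (auto simp: underS_def)
  moreover from this have "tau_op (tau_level r \<F> b) \<subseteq> tau_op (\<Union>b\<in>underS r a. tau_level r \<F> b)"
    by (intro tau_op_mono) auto
  ultimately show ?thesis using tau_level_unfold[OF assms(1), of \<F> a] by auto
qed

lemma base_le_tau_level:
  assumes "wf (r - Id)" "left_invariant_family \<F>" "lower_family \<F>"
  shows "\<F> \<subseteq> tau_level r \<F> a"
proof (induction a rule: wf_induct_rule[OF assms(1)])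
  case (1 a)
  show ?case
  proof (cases "underS r a = {}")
    case False
    then have "\<F> \<subseteq> (\<Union>b\<in>underS r a. tau_level r \<F> b)" using 1 by (auto simp: underS_def)
    then have "tau_op \<F> \<subseteq> tau_level r \<F> a"
      using False by (subst tau_level_unfold[OF assms(1)]) (simp add: tau_op_mono)
    then show ?thesis using tau_op_increasing assms by blast
  qed (subst tau_level_unfold[OF assms(1)], simp)
qed

lemma base_le_tau_ord:
  assumes "Well_order r" "left_invariant_family \<F>" "lower_family \<F>"
  shows "\<F> \<subseteq> tau_ord r \<F>"
proof (cases "Field r = {}")
  case False
  then have "\<F> \<subseteq> (\<Union>a\<in>Field r. tau_level r \<F> a)"
    using base_le_tau_level assms by (fastforce simp: well_order_on_def)
  then have "tau_op \<F> \<subseteq> tau_ord r \<F>" using False by (simp add: tau_ord_def tau_op_mono)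
  then show ?thesis using tau_op_increasing assms by blast
qed (simp add: tau_ord_def)

lemma tau_ord_le_fixpoint:
  assumes "Well_order r" "\<F> \<subseteq> H" "tau_op H = H"
  shows "tau_ord r \<F> \<subseteq> H"
proof -
  have wf: "wf (r - Id)" using assms by (simp add: well_order_on_def)
  have op: "tau_op (\<Union>b\<in>S. tau_level r \<F> b) \<subseteq> H" if "\<And>b. b \<in> S \<Longrightarrow> tau_level r \<F> b \<subseteq> H" for S
    using tau_op_mono[of "\<Union>b\<in>S. tau_level r \<F> b" H] that assms(3) by blast
  have level: "tau_level r \<F> a \<subseteq> H" for a
  proof (induction a rule: wf_induct_rule[OF wf])
    case (1 a)
    have "tau_op (\<Union>b\<in>underS r a. tau_level r \<F> b) \<subseteq> H"
      by (rule op) (use 1 in \<open>auto simp: underS_def\<close>)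
    then show ?case using assms(2) by (subst tau_level_unfold[OF wf]) simp
  qed
  have "tau_op (\<Union>b\<in>Field r. tau_level r \<F> b) \<subseteq> H" using op level by blast
  then show ?thesis using assms(2) by (simp add: tau_ord_def)
qed

section \<open>The tree of a set\<close>

primrec meet_translates :: "('g \<times> 'g) list \<Rightarrow> 'g::group_add set \<Rightarrow> 'g set" where
  "meet_translates [] A = A"
| "meet_translates (p # s) A =
     (+) (fst p) ` meet_translates s A \<inter> (+) (snd p) ` meet_translates s A"

definition residual_tree :: "'g::group_add set set \<Rightarrow> 'g set \<Rightarrow> ('g \<times> 'g) list set" where
  "residual_tree \<F> A = {s. (\<forall>p\<in>set s. fst p \<noteq> snd p) \<and> meet_translates s A \<notin> \<F>}"

definition no_branch_family :: "'g::group_add set set \<Rightarrow> 'g set set" where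
  "no_branch_family \<F> = {A. \<nexists>f. \<forall>n. rev_init f n \<in> residual_tree \<F> A}"

lemma meet_translates_snoc: "meet_translates (s @ [p]) A = meet_translates s (meet_translates [p] A)"
  by (induction s) auto

lemma residual_tree_tl:
  assumes "left_invariant_family \<F>" "lower_family \<F>" "p # s \<in> residual_tree \<F> A"
  shows "s \<in> residual_tree \<F> A"
  using assms unfolding residual_tree_def left_invariant_family_def lower_family_def
  by (auto, meson Int_lower1)

lemma residual_tree_suffix:
  assumes "left_invariant_family \<F>" "lower_family \<F>" "u @ s \<in> residual_tree \<F> A"
  shows "s \<in> residual_tree \<F> A"
  using assms(3) by (induction u) (auto dest: residual_tree_tl[OF assms(1,2)])

text \<open>The last entry of a list is the pair applied first. So the part of the tree through the
  first-level node \<open>[(x, y)]\<close> is a copy of the tree of xA \<inter> yA, which links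
  \<tau> to the tree.\<close>

lemma residual_tree_snoc:
  "s @ [p] \<in> residual_tree \<F> A \<longleftrightarrow>
     fst p \<noteq> snd p \<and> s \<in> residual_tree \<F> ((+) (fst p) ` A \<inter> (+) (snd p) ` A)"
  by (auto simp: residual_tree_def meet_translates_snoc)

text \<open>By induction on the rank, each node \<open>s\<close> carries a set in \<tau> of the
  level at \<open>\<rho> s\<close>: a child inside the tree has smaller rank, and a child outside it
  has its set in \<F>, hence in every level.\<close>

lemma tau_ord_if_ranked:
  fixes \<rho> :: "('g::group_add \<times> 'g) list \<Rightarrow> nat"
  assumes r: "Well_order r" "Field r = UNIV"
    and F: "left_invariant_family \<F>" "lower_family \<F>"
    and \<rho>: "\<And>p s. p # s \<in> residual_tree \<F> A \<Longrightarrow> (\<rho> (p # s), \<rho> s) \<in> r - Id"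
  shows "A \<in> tau_ord r \<F>"
\<comment> \<open>If A lies in \<F>, the tree lacks even its root, and the induction gives nothing
  at \<open>[]\<close>.\<close>
proof (cases "A \<in> \<F>")
  case False
  have wf: "wf (r - Id)" using r by (simp add: well_order_on_def)
  have "s \<in> residual_tree \<F> A \<Longrightarrow> meet_translates s A \<in> tau_op (tau_level r \<F> (\<rho> s))" for s
  proof (induction "\<rho> s" arbitrary: s rule: wf_induct_rule[OF wf])
    case (1 s)
    have "meet_translates ((x, y) # s) A \<in> tau_level r \<F> (\<rho> s)" if "x \<noteq> y" for x y
    proof (cases "(x, y) # s \<in> residual_tree \<F> A")
      case True
      then show ?thesis
        using 1(1)[OF \<rho>[OF True]] \<rho>[OF True] tau_op_tau_level_le[OF wf] by blast
    next
      case False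
      then have "meet_translates ((x, y) # s) A \<in> \<F>"
        using that 1(2) by (auto simp: residual_tree_def)
      then show ?thesis using base_le_tau_level[OF wf F] by blast
    qed
    then show ?case by (simp add: tau_op_def)
  qed
  from this[of "[]"] False have "A \<in> tau_op (tau_level r \<F> (\<rho> []))"
    by (simp add: residual_tree_def)
  moreover have "tau_op (tau_level r \<F> (\<rho> [])) \<subseteq> tau_op (\<Union>a\<in>Field r. tau_level r \<F> a)"
    using r(2) by (intro tau_op_mono) auto
  then have "tau_op (tau_level r \<F> (\<rho> [])) \<subseteq> tau_ord r \<F>"
    using r(2) by (simp add: tau_ord_def)
  ultimately show ?thesis by blast
qed (use base_le_tau_ord[OF r(1) F] in blast)

lemma base_le_no_branch_family: "\<F> \<subseteq> no_branch_family \<F>"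
proof
  fix A assume "A \<in> \<F>"
  then have "rev_init f 0 \<notin> residual_tree \<F> A" for f by (simp add: residual_tree_def)
  then show "A \<in> no_branch_family \<F>" unfolding no_branch_family_def by blast
qed

text \<open>Removing the first pair (x, y) turns a branch of the tree of A into one of the tree of
  xA \<inter> yA; prepending it goes back.\<close>

lemma tau_op_no_branch_family:
  fixes \<F> :: "'g::group_add set set"
  assumes F: "left_invariant_family \<F>" "lower_family \<F>"
  shows "tau_op (no_branch_family \<F>) = no_branch_family \<F>"
proof (intro equalityI subsetI)
  fix A assume A: "A \<in> tau_op (no_branch_family \<F>)"
  have False if f: "\<And>n. rev_init f n \<in> residual_tree \<F> A" for f
  proof -
    let ?B = "(+) (fst (f 0)) ` A \<inter> (+) (snd (f 0)) ` A"
    have "fst (f 0) \<noteq> snd (f 0) \<and> rev_init (\<lambda>k. f (Suc k)) n \<in> residual_tree \<F> ?B" for n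
      using f[of "Suc n"] unfolding rev_init_Suc_shift residual_tree_snoc .
    then have "fst (f 0) \<noteq> snd (f 0)" "?B \<notin> no_branch_family \<F>"
      by (auto simp: no_branch_family_def)
    then show False using A by (simp add: tau_op_def)
  qed
  then show "A \<in> no_branch_family \<F>" unfolding no_branch_family_def by blast
next
  fix A assume A: "A \<in> no_branch_family \<F>"
  have "(+) x ` A \<inter> (+) y ` A \<in> no_branch_family \<F>" if "x \<noteq> y" for x y
  proof -
    have False if f: "\<And>n. rev_init f n \<in> residual_tree \<F> ((+) x ` A \<inter> (+) y ` A)" for f
    proof -
      define g where "g = case_nat (x, y) f"
      have g: "rev_init g (Suc n) = rev_init f n @ [(x, y)]" for n
        unfolding rev_init_Suc_shift by (simp add: g_def)
      have "rev_init g (Suc n) \<in> residual_tree \<F> A" for n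
        unfolding g residual_tree_snoc using f \<open>x \<noteq> y\<close> by simp
      then have "rev_init g n \<in> residual_tree \<F> A" for n
        using residual_tree_tl[OF F] by (metis rev_init.simps(2))
      with A show False by (auto simp: no_branch_family_def)
    qed
    then show ?thesis unfolding no_branch_family_def by blast
  qed
  then show "A \<in> tau_op (no_branch_family \<F>)" by (simp add: tau_op_def)
qed

lemma tau_ord_le_no_branch_family:
  assumes "Well_order r" "left_invariant_family \<F>" "lower_family \<F>"
  shows "tau_ord r \<F> \<subseteq> no_branch_family \<F>"
  using tau_ord_le_fixpoint[OF assms(1) base_le_no_branch_family tau_op_no_branch_family[OF assms(2,3)]] .

text \<open>A tree without branches is a well-founded relation on a countable type; extending it to
  a well-order makes \<open>to_nat\<close> a rank function.\<close>

lemma tau_lt_omega1_eq_no_branch_family: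
  fixes \<F> :: "'g::{group_add, countable} set set"
  assumes F: "left_invariant_family \<F>" "lower_family \<F>"
  shows "tau_lt_omega1 \<F> = no_branch_family \<F>"
proof (intro equalityI subsetI)
  fix A assume "A \<in> no_branch_family \<F>"
  then have "wf {(p # s, s) |p s. p # s \<in> residual_tree \<F> A}"
    by (intro wf_tree_if_no_branch) (auto simp: no_branch_family_def intro: residual_tree_tl[OF F])
  then obtain r :: "nat rel" where r: "Well_order r" "Field r = UNIV"
    "\<And>p s. p # s \<in> residual_tree \<F> A \<Longrightarrow> (to_nat (p # s), to_nat s) \<in> r - Id"
    by (rule wf_countable_extends_to_Well_order) blast
  then have "A \<in> tau_ord r \<F>" by (rule tau_ord_if_ranked[OF _ _ F])
  with r(1) show "A \<in> tau_lt_omega1 \<F>" unfolding tau_lt_omega1_def by blast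
qed (use tau_ord_le_no_branch_family[OF _ F] in \<open>auto simp: tau_lt_omega1_def\<close>)

text \<open>Minimality holds because the family is the union of the countable iterates, each of
  which lies in every fixed point above \<F>.\<close>

lemma tau_star_eq_no_branch_family:
  fixes \<F> :: "'g::{group_add, countable} set set"
  assumes F: "left_invariant_family \<F>" "lower_family \<F>"
  shows "tau_star \<F> = no_branch_family \<F>"
  unfolding tau_star_def
proof (rule the_equality)
  have "no_branch_family \<F> \<subseteq> H'" if "\<F> \<subseteq> H'" "tau_op H' = H'" for H'
    using tau_ord_le_fixpoint[OF _ that]
    unfolding tau_lt_omega1_eq_no_branch_family[OF F, symmetric] tau_lt_omega1_def by blast
  then show least: "\<F> \<subseteq> no_branch_family \<F> \<and> tau_op (no_branch_family \<F>) = no_branch_family \<F> \<and>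
    (\<forall>H'. \<F> \<subseteq> H' \<and> tau_op H' = H' \<longrightarrow> no_branch_family \<F> \<subseteq> H')"
    using base_le_no_branch_family tau_op_no_branch_family[OF F] by blast
  show "H = no_branch_family \<F>"
    if "\<F> \<subseteq> H \<and> tau_op H = H \<and> (\<forall>H'. \<F> \<subseteq> H' \<and> tau_op H' = H' \<longrightarrow> H \<subseteq> H')" for H
    using that least by (intro equalityI) simp_all
qed

section \<open>Projections of closed sets along Baire space\<close>

instance bool :: second_countable_topology
proof
  have "open = generate_topology (UNIV :: bool set set)"
    by (intro ext iffI) (auto simp: open_discrete intro: generate_topology.Basis)
  then show "\<exists>B::bool set set. countable B \<and> open = generate_topology B"
    by (intro exI[of _ UNIV]) auto
qed

lemma tendsto_fun_if_eventually_eq: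
  fixes f :: "nat \<Rightarrow> 'i \<Rightarrow> 'a::topological_space"
  assumes "\<And>i. eventually (\<lambda>n. f n i = l i) sequentially"
  shows "f \<longlonglongrightarrow> l"
proof -
  have "limitin (product_topology (\<lambda>i::'i. euclidean :: 'a topology) UNIV) f l sequentially"
    using assms by (auto simp: limitin_componentwise intro: tendsto_eventually)
  then show ?thesis by (simp add: euclidean_product_topology)
qed

text \<open>For Polish spaces this is a normal form of analyticity: all witnesses live in Baire
  space, where countably many can be packed into one.\<close>

definition souslin :: "'a::topological_space set \<Rightarrow> bool" where
  "souslin S \<longleftrightarrow> (\<exists>K :: ('a \<times> (nat \<Rightarrow> nat)) set. closed K \<and> S = fst ` K)"

lemma souslinI:
  assumes "closed K" "\<And>a. a \<in> S \<longleftrightarrow> (\<exists>z :: nat \<Rightarrow> nat. (a, z) \<in> K)"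
  shows "souslin S"
  unfolding souslin_def using assms by (intro exI[of _ K]) force

lemma souslin_closed: "closed S \<Longrightarrow> souslin S"
  by (rule souslinI[of "S \<times> UNIV"]) (auto intro: closed_Times)

text \<open>This serves when the closed set to be tested depends, through the locally constant
  \<open>c\<close>, on a finite part of the point itself.\<close>

lemma closed_locally_constant_family:
  assumes c: "\<And>i. open {x. c x = i}" and K: "\<And>i. closed (K i)" and \<phi>: "continuous_on UNIV \<phi>"
  shows "closed {x. \<phi> x \<in> K (c x)}"
proof -
  have "- {x. \<phi> x \<in> K (c x)} = (\<Union>i. {x. c x = i} \<inter> \<phi> -` (- K i))" by auto
  moreover have "open \<dots>"
    using c K \<phi> by (intro open_UN ballI open_Int open_vimage) auto
  ultimately show ?thesis by (simp add: closed_def)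
qed

lemma continuous_on_reindex:
  "continuous_on UNIV (\<lambda>p :: 'a::topological_space \<times> ('i \<Rightarrow> 'b::topological_space).
     (fst p, \<lambda>k. snd p (h k)))"
  by (intro continuous_on_Pair continuous_on_fst continuous_on_coordinatewise_then_product continuous_on_id
      continuous_on_product_then_coordinatewise[OF continuous_on_snd[OF continuous_on_id]])

lemma open_reindex_eq:
  "open {p :: 'a::topological_space \<times> ('i \<Rightarrow> 'b::discrete_topology).
     rev_init (\<lambda>k. snd p (h k)) n = s}"
proof (induction n arbitrary: s)
  case (Suc n)
  have "{p :: 'a \<times> ('i \<Rightarrow> 'b). rev_init (\<lambda>k. snd p (h k)) (Suc n) = s} =
     (if s = [] then {} else {p. rev_init (\<lambda>k. snd p (h k)) n = tl s} \<inter> (\<lambda>p. snd p (h n)) -` {hd s})"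
    by (cases s) auto
  moreover have "open ((\<lambda>p :: 'a \<times> ('i \<Rightarrow> 'b). snd p (h n)) -` {hd s})"
    by (intro open_vimage open_discrete
        continuous_on_product_then_coordinatewise[OF continuous_on_snd[OF continuous_on_id]])
  ultimately show ?case using Suc by (simp del: rev_init.simps add: open_Int)
qed simp

text \<open>One point of Baire space codes both the branch and, for each of its initial segments, a witness
  for membership.\<close>

lemma souslin_branches:
  fixes S :: "nat list \<Rightarrow> 'a::topological_space set"
  assumes "\<And>s. souslin (S s)"
  shows "souslin {a. \<exists>f. \<forall>n. a \<in> S (rev_init f n)}"
proof -
  obtain K :: "nat list \<Rightarrow> ('a \<times> (nat \<Rightarrow> nat)) set" where K: "\<And>s. closed (K s)" "\<And>s. S s = fst ` K s"
    using assms unfolding souslin_def by metis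
  let ?f = "\<lambda>z k. z (prod_encode (0, k))"
  let ?z = "\<lambda>z n k. z (prod_encode (Suc n, k))"
  let ?L = "{p. \<forall>n. (fst p, ?z (snd p) n) \<in> K (rev_init (?f (snd p)) n)}"
  have "closed ?L"
    by (intro closed_Collect_all closed_locally_constant_family K continuous_on_reindex open_reindex_eq)
  then show ?thesis
  proof (rule souslinI)
    fix a
    show "a \<in> {a. \<exists>f. \<forall>n. a \<in> S (rev_init f n)} \<longleftrightarrow> (\<exists>z. (a, z) \<in> ?L)"
    proof
      assume "a \<in> {a. \<exists>f. \<forall>n. a \<in> S (rev_init f n)}"
      then obtain f where "\<And>n. \<exists>z. (a, z) \<in> K (rev_init f n)"
        using K(2) by force
      then obtain Z where Z: "\<And>n. (a, Z n) \<in> K (rev_init f n)" by metis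
      define z where "z m = (case prod_decode m of (i, k) \<Rightarrow> case_nat f Z i k)" for m
      have "?f z = f" "\<And>n. ?z z n = Z n" by (auto simp: z_def)
      with Z have "(a, z) \<in> ?L" by simp
      then show "\<exists>z. (a, z) \<in> ?L" by blast
    next
      assume "\<exists>z. (a, z) \<in> ?L"
      then show "a \<in> {a. \<exists>f. \<forall>n. a \<in> S (rev_init f n)}"
        using K(2) by (force simp: image_iff)
    qed
  qed
qed

text \<open>If the set attached to a list depends only on its length, every branch imposes the same
  condition.\<close>

lemma souslin_INT:
  fixes S :: "nat \<Rightarrow> 'a::topological_space set"
  assumes "\<And>n. souslin (S n)"
  shows "souslin (\<Inter>n. S n)"
proof -
  have "(\<Inter>n. S n) = {a. \<exists>f :: nat \<Rightarrow> nat. \<forall>n. a \<in> S (length (rev_init f n))}"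
    by (auto simp: rev_init_conv)
  then show ?thesis using souslin_branches[of "\<lambda>s. S (length s)"] assms by simp
qed

lemma souslin_UN:
  fixes S :: "nat \<Rightarrow> 'a::topological_space set"
  assumes "\<And>n. souslin (S n)"
  shows "souslin (\<Union>n. S n)"
proof -
  \<comment> \<open>Lists are reversed, so \<open>last\<close> is the first value of the branch,
    which selects a member of the union; the empty list has selected none and must impose no
    condition.\<close>
  let ?S = "\<lambda>s. if s = [] then UNIV else S (last s)"
  have "rev_init f n = [] \<longleftrightarrow> n = 0" "n > 0 \<Longrightarrow> last (rev_init f n) = f 0" for f :: "nat \<Rightarrow> nat" and n
    by (cases n; simp add: rev_init_Suc_shift del: rev_init.simps(2))+
  then have "(\<Union>n. S n) = {a. \<exists>f :: nat \<Rightarrow> nat. \<forall>n. a \<in> ?S (rev_init f n)}"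
    by (auto; metis zero_less_one not_gr0)
  then show ?thesis using souslin_branches[of ?S] assms by (simp add: souslin_closed)
qed

text \<open>The induction carries S and its complement together, since the Souslin property alone
  does not pass to complements; the generators are clopen.\<close>

lemma souslin_borel:
  fixes S :: "('g::countable \<Rightarrow> bool) set"
  assumes "S \<in> sets borel"
  shows "souslin S"
proof -
  have S: "S \<in> sigma_sets UNIV {{f :: 'g \<Rightarrow> bool. f i \<in> A} |i A. A \<in> sets borel}"
    using assms unfolding sets_PiM_equal_borel[symmetric] sets_PiM_single
    by (simp add: PiE_UNIV_domain)
  then have "souslin S \<and> souslin (- S)"
  proof induction
    case (Basic a)
    then obtain i A where a: "a = (\<lambda>f. f i) -` A" by auto
    have "closed ((\<lambda>f :: 'g \<Rightarrow> bool. f i) -` B)" for B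
      by (intro closed_vimage continuous_on_product_coordinates) (simp add: closed_def open_discrete)
    from this[of A] this[of "- A"] show ?case by (simp add: a souslin_closed vimage_Compl)
  next
    case Empty
    show ?case by (auto intro: souslin_closed)
  next
    case (Compl a)
    then show ?case by (simp add: Compl_eq_Diff_UNIV[symmetric])
  next
    case (Union a)
    then show ?case using souslin_UN[of a] souslin_INT[of "\<lambda>n. - a n"] by simp
  qed
  then show ?thesis ..
qed

section \<open>Souslin sets are analytic\<close>

lemma completely_metrizable_discrete_fun:
  "completely_metrizable_space (euclidean :: ('i::countable \<Rightarrow> 'a::discrete_topology) topology)"
proof -
  have "(euclidean :: 'a topology) = discrete_topology UNIV"
    by (auto simp: topology_eq open_discrete simp flip: open_openin)
  then have "completely_metrizable_space (euclidean :: 'a topology)"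
    by (simp add: completely_metrizable_space_discrete_topology)
  then show ?thesis
    unfolding euclidean_product_topology[symmetric] completely_metrizable_space_product_topology
    by auto
qed

lemma second_countable_euclidean: "second_countable (euclidean :: 'a::second_countable_topology topology)"
proof -
  obtain B :: "'a set set" where B: "countable B" "topological_basis B"
    using ex_countable_basis by blast
  then show ?thesis unfolding second_countable_def
    by (metis open_openin topological_basisE topological_basis_open)
qed

text \<open>\<open>analytic_set\<close> admits only topologies on reals as sources. Pulling the
  topology back along the inverse of \<open>h\<close> makes \<open>h\<close> a homeomorphism onto
  its image.\<close>

lemma polish_topology_copy_on_real:
  fixes X :: "'a topology" and h :: "'a \<Rightarrow> real"
  assumes X: "polish_topology X" and inj: "inj_on h (topspace X)"
  obtains Y :: "real topology" and g where "polish_topology Y" "continuous_map Y X g"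
    "g ` topspace Y = topspace X"
proof
  let ?g = "inv_into (topspace X) h"
  let ?Y = "pullback_topology (h ` topspace X) ?g X"
  have top: "topspace ?Y = h ` topspace X"
    using inj by (auto simp: topspace_pullback_topology inv_into_into)
  have g: "continuous_map ?Y X ?g"
    using continuous_map_pullback[OF continuous_map_id, of _ ?g X] by simp
  have "continuous_map X ?Y h"
    using inj by (intro continuous_map_pullback') (auto intro: continuous_map_eq[OF continuous_map_id])
  then have "homeomorphic_maps X ?Y h ?g"
    using inj g by (auto simp: homeomorphic_maps_def top f_inv_into_f)
  then have "X homeomorphic_space ?Y" unfolding homeomorphic_space_def by blast
  then show "polish_topology ?Y"
    using X homeomorphic_completely_metrizable_space homeomorphic_separable_space
    unfolding polish_topology_def by blast
  show "?g ` topspace ?Y = topspace X" using inj by (force simp: top)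
  show "continuous_map ?Y X ?g" by fact
qed

lemma analytic_set_if_souslin:
  fixes S :: "('g::countable \<Rightarrow> bool) set"
  assumes "souslin S"
  shows "analytic_set S"
proof -
  obtain K :: "(('g \<Rightarrow> bool) \<times> (nat \<Rightarrow> nat)) set" where K: "closed K" "S = fst ` K"
    using assms unfolding souslin_def by blast
  have "completely_metrizable_space (euclidean :: (('g \<Rightarrow> bool) \<times> (nat \<Rightarrow> nat)) topology)"
    by (subst prod_topology_euclidean[symmetric])
       (simp add: completely_metrizable_space_prod_topology completely_metrizable_discrete_fun
         del: prod_topology_euclidean)
  then have polish: "polish_topology (top_of_set K)"
    unfolding polish_topology_def using K(1)
    by (auto intro!: completely_metrizable_space_closedin second_countable_imp_separable_space
        second_countable_subtopology second_countable_euclidean)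
  \<comment> \<open>A point is determined by the set of true statements about its single
    coordinates; sets of naturals then inject into the reals.\<close>
  define j :: "('g \<Rightarrow> bool) \<times> (nat \<Rightarrow> nat) \<Rightarrow> nat set" where
    "j p = {m. case (from_nat m :: 'g + nat \<times> nat) of Inl g \<Rightarrow> fst p g | Inr (k, l) \<Rightarrow> snd p k = l}"
    for p
  have "inj j"
  proof (rule injI)
    fix p q assume eq: "j p = j q"
    have fst_j: "fst p g \<longleftrightarrow> to_nat (Inl g :: 'g + nat \<times> nat) \<in> j p"
      and snd_j: "snd p k = l \<longleftrightarrow> to_nat (Inr (k, l) :: 'g + nat \<times> nat) \<in> j p" for p g k l
      by (simp_all add: j_def)
    have "fst p g = fst q g" "snd p k = snd q k" for g k
      using fst_j[of p g] fst_j[of q g] snd_j[of p k "snd p k"] snd_j[of q k "snd p k"]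
      by (simp_all add: eq)
    then show "p = q" by (auto simp: prod_eq_iff)
  qed
  moreover obtain e :: "nat set \<Rightarrow> real" where "inj e"
    using nat_sets_eqpoll_reals by (auto simp: eqpoll_def bij_betw_def)
  ultimately have "inj_on (\<lambda>p. e (j p)) (topspace (top_of_set K))"
    unfolding inj_on_def by (metis UNIV_I)
  from polish_topology_copy_on_real[OF polish this]
  obtain Y :: "real topology" and g where Y: "polish_topology Y" "continuous_map Y (top_of_set K) g"
      "g ` topspace Y = K"
    by auto
  have "continuous_map (top_of_set K) euclidean (fst :: _ \<Rightarrow> 'g \<Rightarrow> bool)"
    by (simp add: continuous_on_fst continuous_on_id)
  from continuous_map_compose[OF Y(2) this] show ?thesis
    unfolding analytic_set_def using Y K(2) by (intro exI[of _ Y] exI[of _ "fst \<circ> g"])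
      (auto simp: image_comp[symmetric])
qed

section \<open>Boundedness\<close>

text \<open>If \<open>A\<close> lies in the projections of all \<open>K t\<close>, \<open>t\<close> a suffix of \<open>s\<close>, record \<open>s\<close> together
  with the first \<open>length s\<close> values of \<open>A\<close> and of the chosen witnesses. There are only countably many
  such records, and along an infinite chain of records the points and the witnesses converge, so that
  closedness yields a single point with an infinite branch.\<close>

lemma closed_projections_bounded:
  fixes K :: "'a::countable list \<Rightarrow> (('g::countable \<Rightarrow> bool) \<times> (nat \<Rightarrow> nat)) set"
  assumes K: "\<And>s. closed (K s)"
    and nobranch: "\<nexists>A f. \<forall>n. A \<in> fst ` K (rev_init f n)"
  obtains W :: "nat rel" and \<rho> :: "('g \<Rightarrow> bool) \<Rightarrow> 'a list \<Rightarrow> nat"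
  where "wf W"
    "\<And>A p s. (\<And>u t. p # s = u @ t \<Longrightarrow> A \<in> fst ` K t) \<Longrightarrow> (\<rho> A (p # s), \<rho> A s) \<in> W"
proof -
  define Z where "Z A t = (SOME z. (A, z) \<in> K t)" for A t
  define valid where "valid A s \<longleftrightarrow> (\<forall>u t. s = u @ t \<longrightarrow> (A, Z A t) \<in> K t)" for A s
  define agree where "agree n s A B \<longleftrightarrow> (\<forall>g. to_nat g < n \<longrightarrow> A g = B g) \<and>
      (\<forall>u t i. s = u @ t \<longrightarrow> i < n \<longrightarrow> Z A t i = Z B t i)" for n s A B
  have agree_sym: "agree n s A B \<Longrightarrow> agree n s B A" for n s A B
    by (simp add: agree_def)
  have agree_trans: "agree n s A B \<Longrightarrow> agree n s B C \<Longrightarrow> agree n s A C" for n s A B C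
    by (simp add: agree_def)
  have agree_mono: "agree m (u @ s) A B \<Longrightarrow> n \<le> m \<Longrightarrow> agree n s A B" for m n u s A B
    unfolding agree_def by (metis append_assoc order_less_le_trans)
  \<comment> \<open>Agreement is asked only to the depth of the shorter list; it deepens along a
    chain, so every coordinate is eventually frozen.\<close>
  define W' where "W' = {((B, t), (A, s)). valid B t \<and> valid A s \<and> (\<exists>p. t = p # s) \<and>
      agree (length s) s A B}"
  have "wf W'"
  proof (rule ccontr)
    assume "\<not> wf W'"
    then obtain c where c: "\<And>k. (c (Suc k), c k) \<in> W'"
      unfolding wf_iff_no_infinite_down_chain by blast
    define A where "A k = fst (c k)" for k
    define s where "s k = snd (c k)" for k
    have step: "valid (A k) (s k) \<and> (\<exists>p. s (Suc k) = p # s k) \<and>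
        agree (length (s k)) (s k) (A k) (A (Suc k))"
      for k using c[of k] by (auto simp: W'_def A_def s_def split: prod.splits)
    note ext = chain_append[of s, OF step[THEN conjunct2, THEN conjunct1]]
    note len = chain_length[of s, OF step[THEN conjunct2, THEN conjunct1]]
    have agree_later: "agree (length (s k)) (s k) (A k) (A (k + j))" for k j
    proof (induction j)
      case 0
      show ?case by (simp add: agree_def)
    next
      case (Suc j)
      obtain u where u: "s (k + j) = u @ s k" using ext by blast
      have "agree (length (s k)) (s k) (A (k + j)) (A (Suc (k + j)))"
        by (rule agree_mono[of "length (u @ s k)" u]) (use step[of "k + j"] u in auto)
      with Suc show ?case by (metis agree_trans add_Suc_right)
    qed
    obtain f where f: "\<And>n. \<exists>u. s n = u @ rev_init f n"
      using chain_has_branch[of s] step by blast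
    \<comment> \<open>Since \<open>s k\<close> has length at least \<open>k\<close>, the value at
      \<open>g\<close> no longer changes from this stage on.\<close>
    define B where "B g = A (Suc (to_nat g)) g" for g
    have A_lim: "A \<longlonglongrightarrow> B"
    proof (rule tendsto_fun_if_eventually_eq)
      fix g
      have "A k g = B g" if "k \<ge> Suc (to_nat g)" for k
        using agree_later[of "Suc (to_nat g)" "k - Suc (to_nat g)"] len[of "Suc (to_nat g)"] that
        by (simp add: agree_def B_def)
      then show "\<forall>\<^sub>F k in sequentially. A k g = B g"
        unfolding eventually_sequentially by blast
    qed
    have "B \<in> fst ` K (rev_init f n)" for n
    proof -
      let ?t = "rev_init f n"
      have suff: "\<exists>u. s (n + k) = u @ ?t" for k
        using f[of n] ext[of n k] by (metis append_assoc)
      \<comment> \<open>From stage \<open>n\<close> on, \<open>?t\<close> is a suffix; at stage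
        \<open>n + Suc i\<close> the length also exceeds \<open>i\<close>, so entry \<open>i\<close>
        of the witness is frozen.\<close>
      define z where "z i = Z (A (n + Suc i)) ?t i" for i
      have "(\<lambda>k. Z (A (n + k)) ?t) \<longlonglongrightarrow> z"
      proof (rule tendsto_fun_if_eventually_eq)
        fix i
        have "Z (A (n + k)) ?t i = z i" if "k \<ge> Suc i" for k
          using agree_later[of "n + Suc i" "k - Suc i"] len[of "n + Suc i"] suff[of "Suc i"] that
          by (auto simp: agree_def z_def)
        then show "\<forall>\<^sub>F k in sequentially. Z (A (n + k)) ?t i = z i"
          unfolding eventually_sequentially by blast
      qed
      moreover have "(\<lambda>k. A (n + k)) \<longlonglongrightarrow> B"
        using LIMSEQ_ignore_initial_segment[OF A_lim, of n] by (simp add: add.commute)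
      ultimately have lim: "(\<lambda>k. (A (n + k), Z (A (n + k)) ?t)) \<longlonglongrightarrow> (B, z)"
        by (intro tendsto_Pair)
      have "(A (n + k), Z (A (n + k)) ?t) \<in> K ?t" for k
        using step[of "n + k"] suff[of k] by (auto simp: valid_def)
      then have "(B, z) \<in> K ?t" by (rule closed_sequentially[OF K _ lim])
      then show ?thesis by force
    qed
    with nobranch show False by blast
  qed
  \<comment> \<open>The lists \<open>drop j s\<close> run through all suffixes, the empty one
    included, so equal codes force agreement.\<close>
  define code where "code A s = to_nat (s, map (\<lambda>m. A (from_nat m :: 'g)) [0..<length s],
      map (\<lambda>j. map (Z A (drop j s)) [0..<length s]) [0..<Suc (length s)])" for A s
  have code_eq: "s = s' \<and> agree (length s) s A A'" if "code A s = code A' s'" for A s A' s'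
  proof -
    have s: "s' = s" using that by (simp add: code_def)
    have "A g = A' g" if "to_nat g < length s" for g
      using \<open>code A s = code A' s'\<close> that by (auto simp: code_def s dest!: bspec[of _ _ "to_nat g"])
    moreover have "Z A t i = Z A' t i" if "s = u @ t" "i < length s" for u t i
    proof -
      have "\<forall>j\<in>{0..<Suc (length s)}. \<forall>i\<in>{0..<length s}. Z A (drop j s) i = Z A' (drop j s) i"
        using \<open>code A s = code A' s'\<close> by (simp add: code_def s del: upt_Suc)
      from this[rule_format, of "length u" i] that show ?thesis by simp
    qed
    ultimately show ?thesis by (simp add: s agree_def)
  qed
  \<comment> \<open>A code forgets all but finitely much of its point, so it is decoded to some
    valid pair with that code; pulling \<open>W'\<close> back gives a relation on naturals.\<close>
  define rep where "rep m = (SOME (A, s). valid A s \<and> code A s = m)" for m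
  have rep: "\<exists>B. rep (code A s) = (B, s) \<and> valid B s \<and> agree (length s) s A B" if "valid A s" for A s
  proof -
    have "case rep (code A s) of (B, t) \<Rightarrow> valid B t \<and> code B t = code A s"
      unfolding rep_def by (rule someI[of _ "(A, s)"]) (simp add: that)
    then obtain B t where B: "rep (code A s) = (B, t)" "valid B t" "code B t = code A s"
      by (cases "rep (code A s)") auto
    with code_eq[OF B(3)[symmetric]] show ?thesis by auto
  qed
  show thesis
  proof
    show "wf (inv_image W' rep)" using \<open>wf W'\<close> by (rule wf_inv_image)
    fix A p s assume *: "\<And>u t. p # s = u @ t \<Longrightarrow> A \<in> fst ` K t"
    have "(A, Z A t) \<in> K t" if "p # s = u @ t" for u t
    proof -
      have "\<exists>z. (A, z) \<in> K t" using *[OF that] by force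
      then show ?thesis unfolding Z_def by (rule someI_ex)
    qed
    then have v: "valid A (p # s)" "valid A s"
      unfolding valid_def by (metis append_Cons)+
    obtain B where B: "rep (code A (p # s)) = (B, p # s)" "valid B (p # s)"
      "agree (length (p # s)) (p # s) A B" using rep[OF v(1)] by blast
    obtain C where C: "rep (code A s) = (C, s)" "valid C s" "agree (length s) s A C"
      using rep[OF v(2)] by blast
    \<comment> \<open>The codes may be decoded to different points B and C, yet both agree with A to
      the depth of \<open>s\<close>, as \<open>W'\<close> demands.\<close>
    have "agree (length s) s A B"
      using B(3) agree_mono[of "length (p # s)" "[p]" s] by simp
    then have "agree (length s) s C B" using C(3) agree_sym agree_trans by blast
    then show "(code A (p # s), code A s) \<in> inv_image W' rep"
      using B C by (simp add: W'_def)
  qed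
qed

section \<open>Borel families\<close>

lemma mem_char_fam_iff: "a \<in> char_fam \<F> \<longleftrightarrow> Collect a \<in> \<F>"
  unfolding char_fam_def by (auto simp: image_iff intro!: bexI[of _ "Collect a"])

lemma borel_family_UN:
  assumes "countable I" "\<And>i. i \<in> I \<Longrightarrow> borel_family (\<F> i)"
  shows "borel_family (\<Union>i\<in>I. \<F> i)"
proof -
  have "char_fam (\<Union>i\<in>I. \<F> i) = (\<Union>i\<in>I. char_fam (\<F> i))" by (auto simp: char_fam_def)
  then show ?thesis using assms by (auto simp: borel_family_def intro: sets.countable_UN')
qed

text \<open>The map is even continuous: at each step a new coordinate is the minimum, that is the
  conjunction, of two old ones.\<close>

lemma meet_translates_measurable:
  fixes s :: "('g::group_add \<times> 'g) list"
  shows "(\<lambda>a g. g \<in> meet_translates s (Collect a)) \<in> borel_measurable borel"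
proof (rule borel_measurable_continuous_onI, induction s)
  case (Cons p s)
  have translate: "g \<in> (+) x ` B \<longleftrightarrow> - x + g \<in> B" for x g :: 'g and B
  proof
    assume "- x + g \<in> B"
    then show "g \<in> (+) x ` B"
      by (intro image_eqI[of _ _ "- x + g"]) (simp_all add: add.assoc[symmetric])
  qed (auto simp: add.assoc[symmetric])
  let ?\<psi> = "\<lambda>a g. g \<in> meet_translates s (Collect a)"
  have eq: "(\<lambda>a g. g \<in> meet_translates (p # s) (Collect a)) =
      (\<lambda>a g. min (?\<psi> a (- fst p + g)) (?\<psi> a (- snd p + g)))"
    by (auto simp: fun_eq_iff min_def translate)
  show ?case
    unfolding eq
    by (intro continuous_on_coordinatewise_then_product continuous_on_min
        continuous_on_product_then_coordinatewise[OF Cons])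
qed (simp add: continuous_on_id)

lemma borel_residual_set:
  assumes "borel_family \<F>"
  shows "{a. s \<in> residual_tree \<F> (Collect a)} \<in> sets borel"
proof (cases "\<forall>p\<in>set s. fst p \<noteq> snd p")
  case True
  then have "{a. s \<in> residual_tree \<F> (Collect a)} =
      (\<lambda>a g. g \<in> meet_translates s (Collect a)) -` (- char_fam \<F>) \<inter> space borel"
    by (auto simp: residual_tree_def mem_char_fam_iff)
  also have "\<dots> \<in> sets borel"
    using assms by (intro measurable_sets[OF meet_translates_measurable]) (simp add: borel_family_def)
  finally show ?thesis .
next
  case False
  then have "{a. s \<in> residual_tree \<F> (Collect a)} = {}" by (auto simp: residual_tree_def)
  then show ?thesis by simp
qed

lemma borel_family_tau_op:
  fixes \<F> :: "'g::{group_add, countable} set set"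
  assumes "borel_family \<F>"
  shows "borel_family (tau_op \<F>)"
proof -
  \<comment> \<open>A set is in \<tau>(\<F>) iff its tree has no one-element list, and there are
    countably many pairs.\<close>
  have "char_fam (tau_op \<F>) = (\<Inter>p. - {a. [p] \<in> residual_tree \<F> (Collect a)})"
    by (fastforce simp: mem_char_fam_iff tau_op_def residual_tree_def)
  also have "\<dots> \<in> sets borel"
    by (intro sets.countable_INT'' borel_comp borel_residual_set assms) auto
  finally show ?thesis by (simp add: borel_family_def)
qed

lemma borel_family_tau_ord:
  fixes \<F> :: "'g::{group_add, countable} set set"
  assumes "Well_order r" "borel_family \<F>"
  shows "borel_family (tau_ord r \<F>)"
proof -
  have wf: "wf (r - Id)" using assms by (simp add: well_order_on_def)
  have level: "borel_family (tau_level r \<F> a)" for a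
  proof (induction a rule: wf_induct_rule[OF wf])
    case (1 a)
    have "borel_family (\<Union>b\<in>underS r a. tau_level r \<F> b)"
      by (rule borel_family_UN) (use 1 in \<open>auto simp: underS_def\<close>)
    then show ?case
      using assms(2) by (subst tau_level_unfold[OF wf]) (simp add: borel_family_tau_op)
  qed
  then show ?thesis
    using assms(2) by (simp add: tau_ord_def borel_family_tau_op borel_family_UN)
qed

lemma coanalytic_no_branch_family:
  fixes \<F> :: "'g::{group_add, countable} set set"
  assumes "borel_family \<F>"
  shows "coanalytic_family (no_branch_family \<F>)"
proof -
  \<comment> \<open>\<open>souslin_branches\<close> works with lists of naturals; as
    \<open>from_nat\<close> is onto, coding the pairs loses no branch.\<close>
  let ?S = "\<lambda>s :: nat list. {a. map from_nat s \<in> residual_tree \<F> (Collect a)}"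
  have map: "map h (rev_init f n) = rev_init (\<lambda>k. h (f k)) n" for h :: "'a \<Rightarrow> 'b" and f n
    by (induction n) auto
  have "a \<in> UNIV - char_fam (no_branch_family \<F>) \<longleftrightarrow> (\<exists>f. \<forall>n. a \<in> ?S (rev_init f n))" for a
  proof
    assume "a \<in> UNIV - char_fam (no_branch_family \<F>)"
    then obtain f where "\<And>n. rev_init f n \<in> residual_tree \<F> (Collect a)"
      by (auto simp: mem_char_fam_iff no_branch_family_def)
    then have "\<forall>n. a \<in> ?S (rev_init (\<lambda>k. to_nat (f k)) n)"
      by (simp add: map)
    then show "\<exists>f. \<forall>n. a \<in> ?S (rev_init f n)" by blast
  next
    assume "\<exists>f. \<forall>n. a \<in> ?S (rev_init f n)"
    then show "a \<in> UNIV - char_fam (no_branch_family \<F>)"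
      by (auto simp: mem_char_fam_iff no_branch_family_def map)
  qed
  then have "UNIV - char_fam (no_branch_family \<F>) = {a. \<exists>f. \<forall>n. a \<in> ?S (rev_init f n)}" by blast
  moreover have "souslin \<dots>"
    by (intro souslin_branches souslin_borel borel_residual_set assms)
  ultimately show ?thesis
    unfolding coanalytic_family_def by (simp add: analytic_set_if_souslin)
qed

lemma borel_no_branch_family_bounded:
  fixes \<F> :: "'g::{group_add, countable} set set"
  assumes F: "borel_family \<F>" "left_invariant_family \<F>" "lower_family \<F>"
    and borel: "borel_family (no_branch_family \<F>)"
  obtains r :: "nat rel" where "Well_order r" "no_branch_family \<F> \<subseteq> tau_ord r \<F>"
proof -
  \<comment> \<open>Borelness of the fixed point makes these sets Souslin, and restricting to it
    excludes a point with an infinite branch, as boundedness requires.\<close>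
  define S where "S s = char_fam (no_branch_family \<F>) \<inter> {a. s \<in> residual_tree \<F> (Collect a)}" for s
  have "souslin (S s)" for s
    unfolding S_def using borel borel_residual_set[OF F(1)]
    by (intro souslin_borel sets.Int) (auto simp: borel_family_def)
  then obtain K :: "('g \<times> 'g) list \<Rightarrow> (('g \<Rightarrow> bool) \<times> (nat \<Rightarrow> nat)) set"
    where K: "\<And>s. closed (K s)" "\<And>s. S s = fst ` K s"
    unfolding souslin_def by metis
  have "\<nexists>a f. \<forall>n. a \<in> fst ` K (rev_init f n)"
    unfolding K(2)[symmetric] by (auto simp: S_def mem_char_fam_iff no_branch_family_def)
  from closed_projections_bounded[OF K(1) this]
  obtain W :: "nat rel" and \<rho> where "wf W"
    and \<rho>: "\<And>a p s. (\<And>u t. p # s = u @ t \<Longrightarrow> a \<in> fst ` K t) \<Longrightarrow> (\<rho> a (p # s), \<rho> a s) \<in> W"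
    by blast
  obtain r :: "nat rel" where r: "Well_order r" "Field r = UNIV"
    and W: "\<And>x y. (x, y) \<in> W \<Longrightarrow> (to_nat x, to_nat y) \<in> r - Id"
    using wf_countable_extends_to_Well_order[OF \<open>wf W\<close>] by blast
  \<comment> \<open>The order \<open>r\<close> was fixed before A, and only the rank function varies
    with A; this uniformity is the bound.\<close>
  have "A \<in> tau_ord r \<F>" if A: "A \<in> no_branch_family \<F>" for A
  proof (rule tau_ord_if_ranked[OF r F(2,3)])
    let ?a = "\<lambda>g. g \<in> A"
    fix p s assume ps: "p # s \<in> residual_tree \<F> A"
    have "?a \<in> fst ` K t" if "p # s = u @ t" for u t
      using residual_tree_suffix[OF F(2,3), of u t A] ps that A
      unfolding K(2)[symmetric] by (simp add: S_def mem_char_fam_iff)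
    then show "(to_nat (\<rho> ?a (p # s)), to_nat (\<rho> ?a s)) \<in> r - Id"
      by (intro W \<rho>)
  qed
  with r that show thesis by blast
qed

theorem theorem7p1:
  fixes \<F> :: "'g::{group_add, countable} set set"
  assumes "borel_family \<F>"
    and "left_invariant_family \<F>"
    and "lower_family \<F>"
  shows "(\<forall>r::nat rel. Well_order r \<longrightarrow> borel_family (tau_ord r \<F>))
     \<and> tau_star \<F> = tau_lt_omega1 \<F>
     \<and> coanalytic_family (tau_star \<F>)
     \<and> ((\<forall>r::nat rel. Well_order r \<longrightarrow> tau_star \<F> \<noteq> tau_ord r \<F>)
          \<longrightarrow> \<not> borel_family (tau_star \<F>))"
proof (intro conjI)
  show "\<forall>r::nat rel. Well_order r \<longrightarrow> borel_family (tau_ord r \<F>)"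
    using borel_family_tau_ord assms(1) by blast
  note star = tau_star_eq_no_branch_family[OF assms(2,3)]
  show "tau_star \<F> = tau_lt_omega1 \<F>"
    by (simp add: star tau_lt_omega1_eq_no_branch_family[OF assms(2,3)])
  show "coanalytic_family (tau_star \<F>)"
    using coanalytic_no_branch_family[OF assms(1)] by (simp add: star)
  show "(\<forall>r::nat rel. Well_order r \<longrightarrow> tau_star \<F> \<noteq> tau_ord r \<F>) \<longrightarrow> \<not> borel_family (tau_star \<F>)"
  proof (intro impI notI)
    assume *: "\<forall>r::nat rel. Well_order r \<longrightarrow> tau_star \<F> \<noteq> tau_ord r \<F>"
    assume "borel_family (tau_star \<F>)"
    then obtain r :: "nat rel" where "Well_order r" "tau_star \<F> \<subseteq> tau_ord r \<F>"
      using borel_no_branch_family_bounded[OF assms] by (metis star)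
    then show False
      using * tau_ord_le_no_branch_family[OF _ assms(2,3)] unfolding star by (metis equalityI)
  qed
qed

end
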